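(* Let $D_+,D_-$ be the $2n\times2n$ upwind Active Flux matrices given by $$(D_\pm\mathbf u)_i=\frac{u_{i+1/2}-u_{i-1/2}}{\Delta x},\qquad (D_+\mathbf u)_{i+1/2}=\frac{-4u_{i+1/2}+6u_{i+1}-2u_{i+3/2}}{\Delta x},\qquad (D_-\mathbf u)_{i+1/2}=\frac{2u_{i-1/2}-6u_i+4u_{i+1/2}}{\Delta x}.$$ Then $D_-$ and $D_+$ are nullspace consistent, i.e. for each of the two signs, $D_\pm\mathbf u=\mathbf 0$ if and only if $\mathbf u=c\,\mathbf 1$ for some $c\in\mathbb R$.
   Context: Uniform periodic grid with $n$ cells of size $\Delta x>0$. The unknowns are cell averages $u_i$ and interface point values $u_{i+1/2}$, with $u_{i+n}=u_i$, $u_{i+n+1/2}=u_{i+1/2}$ (cell indices modulo $n$), collected in $\mathbf u=(u_{-1/2},u_0,u_{1/2},u_1,\dots,u_{n-3/2},u_{n-1})^T\in\mathbb R^{2n}$. For a $2n\times2n$ matrix $A$, $(A\mathbf u)_i$ and $(A\mathbf u)_{i+1/2}$ denote the components of $A\mathbf u$ at the positions of $u_i$ and $u_{i+1/2}$. $\mathbf 1$ is the all-ones vector and $\mathbf 0$ the zero vector. *)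

theory Defs
  imports "Jordan_Normal_Form.Matrix"
begin

text \<open>The vector of unknowns is ordered as
  $(u_{-1/2}, u_0, u_{1/2}, u_1, \dots, u_{n-3/2}, u_{n-1})$, so with positions counted from 0
  the cell average $u_i$ sits at position $2i+1$ and the point value $u_{i+1/2}$ at position
  $2i+2$. Cell indices are integers, and taking positions modulo $2n$ makes the grid periodic.\<close>

definition cell_pos :: "nat \<Rightarrow> int \<Rightarrow> nat" where
  "cell_pos n i = nat ((2 * i + 1) mod (2 * int n))"

definition point_pos :: "nat \<Rightarrow> int \<Rightarrow> nat" where
  "point_pos n i = nat ((2 * i + 2) mod (2 * int n))"

text \<open>\<open>cell u i\<close> is $u_i$, and \<open>point u i\<close> is $u_{i+1/2}$ (not $u_i$): the half is implicit.
  The number of cells is read off from the dimension $2n$ of the vector.\<close>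

definition cell :: "real vec \<Rightarrow> int \<Rightarrow> real" where
  "cell u i = u $ cell_pos (dim_vec u div 2) i"

definition point :: "real vec \<Rightarrow> int \<Rightarrow> real" where
  "point u i = u $ point_pos (dim_vec u div 2) i"

text \<open>The matrix whose action on \<open>u\<close> has component \<open>F u i\<close> at the position of $u_i$ and
  \<open>G u i\<close> at the position of $u_{i+1/2}$, for \<open>F\<close> and \<open>G\<close> linear in \<open>u\<close>: entry $(r,c)$ is
  the row formula for position $r$ evaluated at the unit vector $e_c$.\<close>

definition stencil_mat ::
  "nat \<Rightarrow> (real vec \<Rightarrow> int \<Rightarrow> real) \<Rightarrow> (real vec \<Rightarrow> int \<Rightarrow> real) \<Rightarrow> real mat" where
  "stencil_mat n F G = mat (2 * n) (2 * n) (\<lambda>(r, c).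
     if odd r then F (unit_vec (2 * n) c) (int (r div 2))
     else G (unit_vec (2 * n) c) (int (r div 2) - 1))"

definition D_plus :: "nat \<Rightarrow> real \<Rightarrow> real mat" where
  "D_plus n dx = stencil_mat n
     (\<lambda>u i. (point u i - point u (i - 1)) / dx)
     (\<lambda>u i. (- 4 * point u i + 6 * cell u (i + 1) - 2 * point u (i + 1)) / dx)"

definition D_minus :: "nat \<Rightarrow> real \<Rightarrow> real mat" where
  "D_minus n dx = stencil_mat n
     (\<lambda>u i. (point u i - point u (i - 1)) / dx)
     (\<lambda>u i. (2 * point u (i - 1) - 6 * cell u i + 4 * point u i) / dx)"

definition ones_vec :: "nat \<Rightarrow> real vec" where
  "ones_vec m = vec m (\<lambda>_. 1)"

definition nullspace_consistent :: "real mat \<Rightarrow> bool" where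
  "nullspace_consistent D \<longleftrightarrow>
     (\<forall>u \<in> carrier_vec (dim_col D).
        D *\<^sub>v u = 0\<^sub>v (dim_row D) \<longleftrightarrow> (\<exists>c::real. u = c \<cdot>\<^sub>v ones_vec (dim_col D)))"

lemma cell_pos_less: "n > 0 \<Longrightarrow> cell_pos n i < 2 * n"
  unfolding cell_pos_def by (simp add: nat_less_iff)

lemma point_pos_less: "n > 0 \<Longrightarrow> point_pos n i < 2 * n"
  unfolding point_pos_def by (simp add: nat_less_iff)

lemma cell_pos_periodic: "cell_pos n (i + int n) = cell_pos n i"
proof -
  have "2 * (i + int n) + 1 = (2 * i + 1) + 2 * int n" by simp
  then show ?thesis unfolding cell_pos_def by (metis mod_add_self2)
qed

lemma point_pos_periodic: "point_pos n (i + int n) = point_pos n i"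
proof -
  have "2 * (i + int n) + 2 = (2 * i + 2) + 2 * int n" by simp
  then show ?thesis unfolding point_pos_def by (metis mod_add_self2)
qed

lemma cell_pos_mod: "n > 0 \<Longrightarrow> cell_pos n i = 2 * nat (i mod int n) + 1"
proof -
  assume n: "n > 0"
  have "(2 * i + 1) mod (2 * int n) = 2 * (i mod int n) + 1"
    using pos_zmod_mult_2[of "int n" i] n by (simp add: add.commute)
  then show ?thesis unfolding cell_pos_def using n by (simp add: nat_add_distrib nat_mult_distrib)
qed

lemma point_pos_mod: "n > 0 \<Longrightarrow> point_pos n i = 2 * nat ((i + 1) mod int n)"
proof -
  assume n: "n > 0"
  have "2 * i + 2 = 2 * (i + 1)" by simp
  then have "(2 * i + 2) mod (2 * int n) = 2 * ((i + 1) mod int n)"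
    by (simp only: mult_mod_right)
  then show ?thesis unfolding point_pos_def by (simp add: nat_mult_distrib)
qed

lemma row_sum_unit:
  fixes u :: "real vec"
  assumes u: "u \<in> carrier_vec m" and "p < m"
  shows "(\<Sum>c<m. unit_vec m c $ p * u $ c) = u $ p"
proof -
  have "(\<Sum>c<m. unit_vec m c $ p * u $ c) = (\<Sum>c<m. if c = p then u $ c else 0)"
    by (rule sum.cong) (use assms in \<open>auto simp: unit_vec_def\<close>)
  then show ?thesis using assms by simp
qed

text \<open>The matrices act as in the defining equations, for every $n \ge 1$ (including $n = 1$,
  where $u_{i+1/2}$ and $u_{i+3/2}$ are the same unknown) and every integer \<open>i\<close>.\<close>

lemma stencil_mat_row:
  assumes n: "n > 0" and u: "u \<in> carrier_vec (2 * n)"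
  shows "cell (stencil_mat n F G *\<^sub>v u) i =
           (\<Sum>c<2 * n. F (unit_vec (2 * n) c) (i mod int n) * u $ c)"
    and "point (stencil_mat n F G *\<^sub>v u) i =
           (\<Sum>c<2 * n. G (unit_vec (2 * n) c) ((i + 1) mod int n - 1) * u $ c)"
proof -
  have d: "dim_vec (stencil_mat n F G *\<^sub>v u) = 2 * n" by (simp add: stencil_mat_def)
  have e: "(stencil_mat n F G *\<^sub>v u) $ r = (\<Sum>c<2 * n. stencil_mat n F G $$ (r, c) * u $ c)"
    if "r < 2 * n" for r
    using that u by (simp add: stencil_mat_def scalar_prod_def atLeast0LessThan)
  show "cell (stencil_mat n F G *\<^sub>v u) i =
           (\<Sum>c<2 * n. F (unit_vec (2 * n) c) (i mod int n) * u $ c)"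
  proof -
    have "cell_pos n i < 2 * n" using n by (rule cell_pos_less)
    moreover have "odd (cell_pos n i)" "int (cell_pos n i div 2) = i mod int n"
      using n by (simp_all add: cell_pos_mod)
    ultimately show ?thesis
      using e[of "cell_pos n i"] by (simp add: cell_def d stencil_mat_def)
  qed
  show "point (stencil_mat n F G *\<^sub>v u) i =
           (\<Sum>c<2 * n. G (unit_vec (2 * n) c) ((i + 1) mod int n - 1) * u $ c)"
  proof -
    have "point_pos n i < 2 * n" using n by (rule point_pos_less)
    moreover have "even (point_pos n i)" "int (point_pos n i div 2) = (i + 1) mod int n"
      using n by (simp_all add: point_pos_mod)
    ultimately show ?thesis
      using e[of "point_pos n i"] by (simp add: point_def d stencil_mat_def)
  qed
qed

lemma cell_unit_sum:
  assumes "n > 0" "u \<in> carrier_vec (2 * n)"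
  shows "(\<Sum>c<2 * n. cell (unit_vec (2 * n) c) i * u $ c) = cell u i"
  using assms row_sum_unit[of u "2 * n" "cell_pos n i"] cell_pos_less[of n i]
  by (simp add: cell_def)

lemma point_unit_sum:
  assumes "n > 0" "u \<in> carrier_vec (2 * n)"
  shows "(\<Sum>c<2 * n. point (unit_vec (2 * n) c) i * u $ c) = point u i"
  using assms row_sum_unit[of u "2 * n" "point_pos n i"] point_pos_less[of n i]
  by (simp add: point_def)

lemma cell_cong:
  assumes "u \<in> carrier_vec (2 * n)" "n > 0" "i mod int n = j mod int n"
  shows "cell u i = cell u j"
  using assms by (simp add: cell_def cell_pos_mod)

lemma point_cong:
  assumes "u \<in> carrier_vec (2 * n)" "n > 0" "i mod int n = j mod int n"
  shows "point u i = point u j"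
proof -
  have "(i + 1) mod int n = (j + 1) mod int n" using assms(3) by (metis mod_add_left_eq)
  then show ?thesis using assms by (simp add: point_def point_pos_mod)
qed

lemma stencil_sum:
  fixes u :: "real vec"
  assumes n: "n > 0" and u: "u \<in> carrier_vec (2 * n)"
  shows "(\<Sum>c<2 * n. ((a * point (unit_vec (2 * n) c) i + b * cell (unit_vec (2 * n) c) j
            + d * point (unit_vec (2 * n) c) k) / dx) * u $ c)
         = (a * point u i + b * cell u j + d * point u k) / dx"
proof -
  have "(\<Sum>c<2 * n. ((a * point (unit_vec (2 * n) c) i + b * cell (unit_vec (2 * n) c) j
            + d * point (unit_vec (2 * n) c) k) / dx) * u $ c)
     = (a * (\<Sum>c<2 * n. point (unit_vec (2 * n) c) i * u $ c)
        + b * (\<Sum>c<2 * n. cell (unit_vec (2 * n) c) j * u $ c)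
        + d * (\<Sum>c<2 * n. point (unit_vec (2 * n) c) k * u $ c)) / dx"
    by (simp add: sum_distrib_left sum_divide_distrib sum.distrib[symmetric]
        distrib_right add_divide_distrib mult.assoc)
  then show ?thesis using n u by (simp only: cell_unit_sum point_unit_sum)
qed

lemma D_action:
  assumes n: "n > 0" and u: "u \<in> carrier_vec (2 * n)"
  shows D_plus_cell: "cell (D_plus n dx *\<^sub>v u) i = (point u i - point u (i - 1)) / dx"
    and D_minus_cell: "cell (D_minus n dx *\<^sub>v u) i = (point u i - point u (i - 1)) / dx"
    and D_plus_point: "point (D_plus n dx *\<^sub>v u) i =
          (- 4 * point u i + 6 * cell u (i + 1) - 2 * point u (i + 1)) / dx"
    and D_minus_point: "point (D_minus n dx *\<^sub>v u) i =
          (2 * point u (i - 1) - 6 * cell u i + 4 * point u i) / dx"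
proof -
  let ?i = "i mod int n" and ?j = "(i + 1) mod int n - 1"
  have m: "?i mod int n = i mod int n" "(?i - 1) mod int n = (i - 1) mod int n"
    "?j mod int n = i mod int n" "(?j - 1) mod int n = (i - 1) mod int n"
    "(?j + 1) mod int n = (i + 1) mod int n"
    by (simp_all add: mod_simps)
  note p = point_cong[OF u n] and c = cell_cong[OF u n]
  note s = stencil_sum[OF n u]
  show "cell (D_plus n dx *\<^sub>v u) i = (point u i - point u (i - 1)) / dx"
    using s[of 1 ?i 0 0 "-1" "?i - 1" dx]
    by (simp add: D_plus_def stencil_mat_row[OF n u] p[OF m(1)] p[OF m(2)])
  show "cell (D_minus n dx *\<^sub>v u) i = (point u i - point u (i - 1)) / dx"
    using s[of 1 ?i 0 0 "-1" "?i - 1" dx]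
    by (simp add: D_minus_def stencil_mat_row[OF n u] p[OF m(1)] p[OF m(2)])
  show "point (D_plus n dx *\<^sub>v u) i =
          (- 4 * point u i + 6 * cell u (i + 1) - 2 * point u (i + 1)) / dx"
    using s[of "-4" ?j 6 "?j + 1" "-2" "?j + 1" dx]
    unfolding p[OF m(3)] p[OF m(5)] c[OF m(5)]
    by (simp add: D_plus_def stencil_mat_row[OF n u])
  show "point (D_minus n dx *\<^sub>v u) i =
          (2 * point u (i - 1) - 6 * cell u i + 4 * point u i) / dx"
    using s[of 2 "?j - 1" "-6" ?j 4 ?j dx]
    unfolding p[OF m(3)] p[OF m(4)] c[OF m(3)]
    by (simp add: D_minus_def stencil_mat_row[OF n u])
qed

end

theory Submission imports Defs begin

text \<open>
  The rows at the cell averages force the differences $u_{i+1/2} - u_{i-1/2}$ to vanish, so that all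
  point values of a vector in the nullspace equal a single number $c$. Each row at a point value is,
  for both signs, a combination $a u_{j-1/2} - (a+b) u_j + b u_{j+1/2}$ with $a + b \neq 0$: the
  coefficients sum to zero, and the cell average $u_j$ occurs with a nonzero one. Zero sum makes
  constants solutions; the nonzero coefficient determines $u_j$ by the two point values bordering
  the cell, hence $u_j = c$. The two signs differ only in the weights and in the cell used: $j = i$,
  $(a, b) = (2, 4)$ for $D_-$, and $j = i + 1$, $(a, b) = (-4, -2)$ for $D_+$.
  Lemma \<open>nullspace_consistentI\<close> carries this argument out for general $a$, $b$ and shift $j - i$.
\<close>

text \<open>Every position below $2n$ is that of a cell average (odd) or a point value (even), so
  vectors can be compared through the stencil coordinates.\<close>

lemma grid_vec_eqI:
  assumes n: "n > 0" and u: "u \<in> carrier_vec (2 * n)" and v: "v \<in> carrier_vec (2 * n)"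
    and cells: "\<And>i. cell u i = cell v i" and points: "\<And>i. point u i = point v i"
  shows "u = v"
proof (rule eq_vecI)
  show "dim_vec u = dim_vec v" using u v by simp
  fix k assume "k < dim_vec v"
  then have k: "k < 2 * n" using v by simp
  show "u $ k = v $ k"
  proof (cases "odd k")
    case True
    then have "cell_pos n (int (k div 2)) = k"
      using n k by (simp add: cell_pos_mod nat_mod_distrib)
    then show ?thesis using cells[of "int (k div 2)"] u v by (simp add: cell_def)
  next
    case False
    then have "point_pos n (int (k div 2) - 1) = k"
      using n k by (simp add: point_pos_mod nat_mod_distrib)
    then show ?thesis using points[of "int (k div 2) - 1"] u v by (simp add: point_def)
  qed
qed

lemma cell_const: "n > 0 \<Longrightarrow> cell (c \<cdot>\<^sub>v ones_vec (2 * n)) i = c"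
  using cell_pos_less[of n i] by (simp add: cell_def ones_vec_def)

lemma point_const: "n > 0 \<Longrightarrow> point (c \<cdot>\<^sub>v ones_vec (2 * n)) i = c"
  using point_pos_less[of n i] by (simp add: point_def ones_vec_def)

lemma cell_zero: "n > 0 \<Longrightarrow> cell (0\<^sub>v (2 * n)) i = 0"
  using cell_pos_less[of n i] by (simp add: cell_def)

lemma point_zero: "n > 0 \<Longrightarrow> point (0\<^sub>v (2 * n)) i = 0"
  using point_pos_less[of n i] by (simp add: point_def)

lemma int_fun_const_if_step:
  fixes f :: "int \<Rightarrow> 'a"
  assumes step: "\<And>i. f i = f (i - 1)"
  shows "f i = f 0"
proof (induction i rule: int_induct[where k = 0])
  case (step1 i)
  then show ?case using step[of "i + 1"] by simp
next
  case (step2 i)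
  then show ?case using step[of i] by simp
qed simp

text \<open>If \<open>a + b\<close> were 0, the cell averages would enter no row, and the nullspace would contain
  every vector with vanishing point values.\<close>

lemma nullspace_consistentI:
  assumes n: "n > 0" and dx: "dx \<noteq> 0" and ab: "a + b \<noteq> 0"
    and D: "D \<in> carrier_mat (2 * n) (2 * n)"
    and cell_row: "\<And>u i. u \<in> carrier_vec (2 * n) \<Longrightarrow>
      cell (D *\<^sub>v u) i = (point u i - point u (i - 1)) / dx"
    and point_row: "\<And>u i. u \<in> carrier_vec (2 * n) \<Longrightarrow>
      point (D *\<^sub>v u) i =
        (a * point u (i + s - 1) - (a + b) * cell u (i + s) + b * point u (i + s)) / dx"
  shows "nullspace_consistent D"
proof -
  have "D *\<^sub>v u = 0\<^sub>v (2 * n) \<longleftrightarrow> (\<exists>c. u = c \<cdot>\<^sub>v ones_vec (2 * n))"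
    if u: "u \<in> carrier_vec (2 * n)" for u
  proof
    assume zero: "D *\<^sub>v u = 0\<^sub>v (2 * n)"
    have "point u i = point u (i - 1)" for i
      using cell_row[OF u, of i] dx by (simp add: zero cell_zero[OF n])
    then have points: "point u i = point u 0" for i
      by (rule int_fun_const_if_step)
    have cells: "cell u i = point u 0" for i
    proof -
      have "a * point u 0 - (a + b) * cell u i + b * point u 0 = 0"
        using point_row[OF u, of "i - s"] dx
        by (simp add: zero point_zero[OF n] points[of i] points[of "i - 1"])
      then have "(a + b) * (point u 0 - cell u i) = 0"
        by (simp add: algebra_simps)
      then show ?thesis using ab by simp
    qed
    have "u = point u 0 \<cdot>\<^sub>v ones_vec (2 * n)"
    proof (rule grid_vec_eqI[OF n u])
      show "point u 0 \<cdot>\<^sub>v ones_vec (2 * n) \<in> carrier_vec (2 * n)"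
        by (simp add: ones_vec_def)
      show "cell u i = cell (point u 0 \<cdot>\<^sub>v ones_vec (2 * n)) i" for i
        using cells cell_const[OF n] by metis
      show "point u i = point (point u 0 \<cdot>\<^sub>v ones_vec (2 * n)) i" for i
        using points point_const[OF n] by metis
    qed
    then show "\<exists>c. u = c \<cdot>\<^sub>v ones_vec (2 * n)" ..
  next
    assume "\<exists>c. u = c \<cdot>\<^sub>v ones_vec (2 * n)"
    then obtain c where c: "u = c \<cdot>\<^sub>v ones_vec (2 * n)" ..
    show "D *\<^sub>v u = 0\<^sub>v (2 * n)"
    proof (rule grid_vec_eqI[OF n])
      show "D *\<^sub>v u \<in> carrier_vec (2 * n)" using D u by simp
      show "cell (D *\<^sub>v u) i = cell (0\<^sub>v (2 * n)) i" for i
        by (simp add: cell_row[OF u] cell_zero[OF n]) (simp add: c point_const[OF n])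
      show "point (D *\<^sub>v u) i = point (0\<^sub>v (2 * n)) i" for i
        by (simp add: point_row[OF u] point_zero[OF n])
          (simp add: c cell_const[OF n] point_const[OF n] distrib_right)
    qed simp
  qed
  then show ?thesis using D by (simp add: nullspace_consistent_def)
qed

theorem lemma6p1:
  fixes n :: nat and dx :: real
  assumes "n \<ge> 1" and "dx > 0"
  shows "nullspace_consistent (D_minus n dx) \<and> nullspace_consistent (D_plus n dx)"
proof
  have n: "n > 0" and dx: "dx \<noteq> 0" using assms by simp_all
  show "nullspace_consistent (D_minus n dx)"
  proof (rule nullspace_consistentI[OF n dx, where a = 2 and b = 4 and s = 0])
    show "D_minus n dx \<in> carrier_mat (2 * n) (2 * n)"
      by (simp add: D_minus_def stencil_mat_def)
  qed (simp_all add: D_minus_cell[OF n] D_minus_point[OF n])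
  show "nullspace_consistent (D_plus n dx)"
  proof (rule nullspace_consistentI[OF n dx, where a = "-4" and b = "-2" and s = 1])
    show "D_plus n dx \<in> carrier_mat (2 * n) (2 * n)"
      by (simp add: D_plus_def stencil_mat_def)
  qed (simp_all add: D_plus_cell[OF n] D_plus_point[OF n])
qed

end
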